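(* Let $g$ be the transducer over $X_4=\{0,1,2,3\}$ with two states $a,b$ and transition/output functions given by $\pi(0,a)=a,\ \lambda(0,a)=0$; $\pi(1,a)=b,\ \lambda(1,a)=0$; $\pi(2,a)=a,\ \lambda(2,a)=1$; $\pi(3,a)=b,\ \lambda(3,a)=1$; $\pi(0,b)=a,\ \lambda(0,b)=2$; $\pi(1,b)=b,\ \lambda(1,b)=2$; $\pi(2,b)=a,\ \lambda(2,b)=3$; $\pi(3,b)=b,\ \lambda(3,b)=3$. Let $1\le r\le 3$ and let $A_{q_0}\in\mathcal{TB}_{4,r}$ be such that $\mathrm{Core}(A_{q_0})$ is equal to $g$. Then $r=3$.
   Context: Notation (with $n=4$). Maps act on the right. $X_n=\{0,\ldots,n-1\}$; $X_n^*$ (resp. $X_n^k$) is the set of finite words (words of length $k$) over $X_n$; $\epsilon$ is the empty word; $\dot{\mathbf r}=\{\dot 0,\ldots,\dot{(r-1)}\}$ is a further ordered alphabet; $X_{n,r}^+=\{\dot a w:\dot a\in\dot{\mathbf r},\,w\in X_n^*\}$, $X_{n,r}^*=X_{n,r}^+\cup\{\epsilon\}$. $\mathfrak C_n=X_n^\omega$ and $\mathfrak C_{n,r}=\{\dot a x:\dot a\in\dot{\mathbf r},\,x\in\mathfrak C_n\}$ are Cantor spaces. The relation $\simeq$ on $\mathfrak C_{n,r}$: $x\simeq y$ iff $x=y$, or $\{x,y\}=\{w\,i\,000\ldots,\;w\,(i-1)(n-1)(n-1)\ldots\}$ with $w\in X_{n,r}^+$ and $0<i\le n-1$, or $\{x,y\}=\{\dot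 c\,00\ldots,\;\dot{(c-1)}(n-1)(n-1)\ldots\}$ with $0<c\le r-1$, or $\{x,y\}=\{\dot 0\,00\ldots,\;\dot{(r-1)}(n-1)(n-1)\ldots\}$. Transducers over $X_n$. A transducer $\langle X_n,Q,\pi,\lambda\rangle$ has transition function $\pi:X_n\times Q\to Q$ and output function $\lambda:X_n\times Q\to X_n^*$, extended to words by $\pi(wi,q)=\pi(i,\pi(w,q))$, $\lambda(wi,q)=\lambda(w,q)\lambda(i,\pi(w,q))$, such that infinite inputs give infinite outputs; $h_q$ is the map $\delta\mapsto\lambda(\delta,q)$ on $\mathfrak C_n$. Transducers over $\mathfrak C_{n,r}$. An initial transducer $A_{q_0}$ over $\mathfrak C_{n,r}$ has state set $Q=R\sqcup S$ with $R$ finite, $q_0\in R$, and functions $\pi,\lambda$ defined on $(\dot{\mathbf r}\times\{q_0\})\sqcup(X_n\times(Q\setminus\{q_0\}))$, $\pi$ with values in $Q\setminus\{q_0\}$ and $\lambda$ with values in $X_{n,r}^*\sqcup X_n^*$, such that: a transition from a state of $R$ outputs $\epsilon$ if it ends in $R$ and a word of $X_{n,r}^+$ if it ends in $S$; transitions from $S$ end in $S$ with output in $X_n^*$; infinite words read from states of $S$ give infinite output; no state of $R$ lies on a cycle. It represents the map $h_{q_0}:\mathfrak C_{n,r}\to\mathfrak C_{n,r}$. It is minimal if all states are reachable from $q_0$, distinct states induce distinct maps, and for every state $q$ and readable letter $i$, $\lambda(i,q)$ is the greatest common prefix of $\{(i\delta)h_q:\delta\in\mathfrak C_n\}$; every homeomorphism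 of $\mathfrak C_{n,r}$ is represented by a unique minimal transducer. It is synchronizing if for some $k$ the state reached by reading a word of length $k$ from any state from which it can be read depends only on the word; its core is then the transducer over $X_n$ formed by the states forced in this way by words of $X_n^k$ (considered up to renaming states). $\mathcal{TB}_{n,r}$ is the group of homeomorphisms $h$ of $\mathfrak C_{n,r}$ that preserve $\simeq$ and are such that the minimal transducers of $h$ and $h^{-1}$ are finite and synchronizing; elements of $\mathcal{TB}_{n,r}$ are identified with their minimal transducers $A_{q_0}$. *)

theory Defs
  imports "HOL-Analysis.Analysis" "HOL-Library.Omega_Words_Fun"
begin

text \<open>
  The dotted letters \<^term>\<open>Dot a\<close> and the letters \<^term>\<open>Ltr i\<close> of \<open>X_n\<close> are kept disjoint.
  Finite words are lists and infinite words are functions on \<^typ>\<open>nat\<close>.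
\<close>

datatype letter = Dot nat | Ltr nat

definition alph :: "nat \<Rightarrow> letter set" where
  "alph n = Ltr ` {..<n}"

definition dots :: "nat \<Rightarrow> letter set" where
  "dots r = Dot ` {..<r}"

definition Xplus :: "nat \<Rightarrow> nat \<Rightarrow> letter list set" where
  "Xplus n r = {a # w | a w. a \<in> dots r \<and> w \<in> lists (alph n)}"

definition Cantor :: "nat \<Rightarrow> letter word set" where
  "Cantor n = {x. \<forall>k. x k \<in> alph n}"

definition Cantor_dot :: "nat \<Rightarrow> nat \<Rightarrow> letter word set" where
  "Cantor_dot n r = {a ## x | a x. a \<in> dots r \<and> x \<in> Cantor n}"

definition cantor_topology :: "nat \<Rightarrow> nat \<Rightarrow> letter word topology" where
  "cantor_topology n r =
     subtopology (product_topology (\<lambda>_. discrete_topology UNIV) UNIV) (Cantor_dot n r)"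

definition const_word :: "nat \<Rightarrow> letter word" where
  "const_word i = (\<lambda>_. Ltr i)"

definition simeq :: "nat \<Rightarrow> nat \<Rightarrow> letter word \<Rightarrow> letter word \<Rightarrow> bool" where
  "simeq n r x y \<longleftrightarrow> x \<in> Cantor_dot n r \<and> y \<in> Cantor_dot n r \<and>
     (x = y \<or>
      (\<exists>w\<in>Xplus n r. \<exists>i. 0 < i \<and> i \<le> n - 1 \<and>
         {x, y} = {(w @ [Ltr i]) \<frown> const_word 0, (w @ [Ltr (i - 1)]) \<frown> const_word (n - 1)}) \<or>
      (\<exists>c. 0 < c \<and> c \<le> r - 1 \<and>
         {x, y} = {[Dot c] \<frown> const_word 0, [Dot (c - 1)] \<frown> const_word (n - 1)}) \<or>
      {x, y} = {[Dot 0] \<frown> const_word 0, [Dot (r - 1)] \<frown> const_word (n - 1)})"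

text \<open>
  In the arguments of \<open>trans_fn\<close> and \<open>out_fn\<close> the letter comes first, as in \<open>\<pi>(i,q)\<close> and
  \<open>\<lambda>(i,q)\<close>. Their values matter only on states and on letters that the state can read.
\<close>

record 'q transducer =
  states :: "'q set"
  trans_fn :: "letter \<Rightarrow> 'q \<Rightarrow> 'q"
  out_fn :: "letter \<Rightarrow> 'q \<Rightarrow> letter list"

fun run :: "('q, 'z) transducer_scheme \<Rightarrow> letter list \<Rightarrow> 'q \<Rightarrow> 'q" where
  "run T [] q = q"
| "run T (i # w) q = run T w (trans_fn T i q)"

fun out_word :: "('q, 'z) transducer_scheme \<Rightarrow> letter list \<Rightarrow> 'q \<Rightarrow> letter list" where
  "out_word T [] q = []"
| "out_word T (i # w) q = out_fn T i q @ out_word T w (trans_fn T i q)"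

lemma run_snoc: "run T (w @ [i]) q = trans_fn T i (run T w q)"
  by (induction w arbitrary: q) auto

lemma out_word_snoc: "out_word T (w @ [i]) q = out_word T w q @ out_fn T i (run T w q)"
  by (induction w arbitrary: q) auto

definition infinite_output :: "('q, 'z) transducer_scheme \<Rightarrow> letter word \<Rightarrow> 'q \<Rightarrow> bool" where
  "infinite_output T x q \<longleftrightarrow> (\<forall>m. \<exists>k. m < length (out_word T (x [0 \<rightarrow> k]) q))"

text \<open>
  The infinite word \<open>\<lambda>(x,q)\<close>: its \<open>m\<close>-th letter is read off the first finite output that is long
  enough. Meaningful when \<^term>\<open>infinite_output T x q\<close> holds.
\<close>

definition omega_output :: "('q, 'z) transducer_scheme \<Rightarrow> 'q \<Rightarrow> letter word \<Rightarrow> letter word" where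
  "omega_output T q x =
     (\<lambda>m. out_word T (x [0 \<rightarrow> (LEAST k. m < length (out_word T (x [0 \<rightarrow> k]) q))]) q ! m)"

text \<open>In an initial transducer the state set is the disjoint union of \<open>rstates\<close> and \<open>sstates\<close>.\<close>

record 'q itransducer = "'q transducer" +
  init :: 'q
  rstates :: "'q set"

definition sstates :: "'q itransducer \<Rightarrow> 'q set" where
  "sstates A = states A - rstates A"

definition letters_at :: "nat \<Rightarrow> nat \<Rightarrow> 'q itransducer \<Rightarrow> 'q \<Rightarrow> letter set" where
  "letters_at n r A q = (if q = init A then dots r else alph n)"

fun readable :: "nat \<Rightarrow> nat \<Rightarrow> 'q itransducer \<Rightarrow> letter list \<Rightarrow> 'q \<Rightarrow> bool" where
  "readable n r A [] q \<longleftrightarrow> True"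
| "readable n r A (i # w) q \<longleftrightarrow> i \<in> letters_at n r A q \<and> readable n r A w (trans_fn A i q)"

definition inputs_at :: "nat \<Rightarrow> nat \<Rightarrow> 'q itransducer \<Rightarrow> 'q \<Rightarrow> letter word set" where
  "inputs_at n r A q = (if q = init A then Cantor_dot n r else Cantor n)"

definition initial_transducer :: "nat \<Rightarrow> nat \<Rightarrow> 'q itransducer \<Rightarrow> bool" where
  "initial_transducer n r A \<longleftrightarrow>
     rstates A \<subseteq> states A \<and> finite (rstates A) \<and> init A \<in> rstates A \<and>
     (\<forall>q\<in>states A. \<forall>i\<in>letters_at n r A q. trans_fn A i q \<in> states A - {init A}) \<and>
     (\<forall>q\<in>rstates A. \<forall>i\<in>letters_at n r A q.
        (trans_fn A i q \<in> rstates A \<longrightarrow> out_fn A i q = []) \<and>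
        (trans_fn A i q \<in> sstates A \<longrightarrow> out_fn A i q \<in> Xplus n r)) \<and>
     (\<forall>q\<in>sstates A. \<forall>i\<in>alph n. trans_fn A i q \<in> sstates A \<and> out_fn A i q \<in> lists (alph n)) \<and>
     (\<forall>q\<in>sstates A. \<forall>x\<in>Cantor n. infinite_output A x q) \<and>
     (\<forall>q\<in>rstates A. \<not> (\<exists>w. w \<noteq> [] \<and> readable n r A w q \<and> run A w q = q))"

definition represents :: "nat \<Rightarrow> nat \<Rightarrow> 'q itransducer \<Rightarrow> (letter word \<Rightarrow> letter word) \<Rightarrow> bool" where
  "represents n r A h \<longleftrightarrow> (\<forall>x\<in>Cantor_dot n r. omega_output A (init A) x = h x)"

definition is_prefix :: "letter list \<Rightarrow> letter word \<Rightarrow> bool" where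
  "is_prefix u x \<longleftrightarrow> (\<exists>y. x = u \<frown> y)"

text \<open>False if the common prefixes are unbounded, i.e. if the set has at most one element.\<close>

definition is_gcp :: "letter list \<Rightarrow> letter word set \<Rightarrow> bool" where
  "is_gcp u Y \<longleftrightarrow> (\<forall>x\<in>Y. is_prefix u x) \<and>
     (\<forall>v. (\<forall>x\<in>Y. is_prefix v x) \<longrightarrow> length v \<le> length u)"

definition minimal :: "nat \<Rightarrow> nat \<Rightarrow> 'q itransducer \<Rightarrow> bool" where
  "minimal n r A \<longleftrightarrow> initial_transducer n r A \<and>
     (\<forall>q\<in>states A. \<exists>w. readable n r A w (init A) \<and> run A w (init A) = q) \<and>
     (\<forall>p\<in>states A. \<forall>q\<in>states A. inputs_at n r A p = inputs_at n r A q \<and>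
        (\<forall>x\<in>inputs_at n r A p. omega_output A p x = omega_output A q x) \<longrightarrow> p = q) \<and>
     (\<forall>q\<in>states A. \<forall>i\<in>letters_at n r A q.
        is_gcp (out_fn A i q) {omega_output A q (i ## x) | x. x \<in> Cantor n})"

definition sync_level :: "nat \<Rightarrow> nat \<Rightarrow> 'q itransducer \<Rightarrow> nat \<Rightarrow> bool" where
  "sync_level n r A k \<longleftrightarrow>
     (\<forall>w p q. length w = k \<and> p \<in> states A \<and> q \<in> states A \<and>
        readable n r A w p \<and> readable n r A w q \<longrightarrow> run A w p = run A w q)"

definition synchronizing :: "nat \<Rightarrow> nat \<Rightarrow> 'q itransducer \<Rightarrow> bool" where
  "synchronizing n r A \<longleftrightarrow> (\<exists>k. sync_level n r A k)"

text \<open>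
  The set of forced states does not depend on the synchronizing level used; the least one is
  chosen. Meaningful for synchronizing transducers only.
\<close>

definition core :: "nat \<Rightarrow> nat \<Rightarrow> 'q itransducer \<Rightarrow> 'q transducer" where
  "core n r A =
     \<lparr>states = {run A w q | w q. w \<in> lists (alph n) \<and> length w = (LEAST k. sync_level n r A k) \<and>
                  q \<in> states A \<and> readable n r A w q},
      trans_fn = trans_fn A,
      out_fn = out_fn A\<rparr>"

text \<open>Equality of transducers over \<open>X_n\<close> up to renaming states.\<close>

definition same_transducer :: "nat \<Rightarrow> 'p transducer \<Rightarrow> 'q transducer \<Rightarrow> bool" where
  "same_transducer n S T \<longleftrightarrow>
     (\<exists>f. bij_betw f (states S) (states T) \<and>
        (\<forall>q\<in>states S. \<forall>i\<in>alph n.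
           f (trans_fn S i q) = trans_fn T i (f q) \<and> out_fn S i q = out_fn T i (f q)))"

text \<open>
  The group, with homeomorphisms identified with their minimal transducers. As the minimal
  transducer of the inverse is required to be finite, its states may be taken in \<^typ>\<open>nat\<close>.
\<close>

definition TB :: "nat \<Rightarrow> nat \<Rightarrow> 'q itransducer set" where
  "TB n r = {A. minimal n r A \<and> finite (states A) \<and> synchronizing n r A \<and>
     (\<exists>h. represents n r A h \<and>
        homeomorphic_map (cantor_topology n r) (cantor_topology n r) h \<and>
        (\<forall>x y. simeq n r x y \<longrightarrow> simeq n r (h x) (h y)) \<and>
        (\<exists>B :: nat itransducer. minimal n r B \<and> finite (states B) \<and> synchronizing n r B \<and>
           represents n r B (inv_into (Cantor_dot n r) h)))}"

datatype g_state = State_a | State_b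

fun g_trans :: "letter \<Rightarrow> g_state \<Rightarrow> g_state" where
  "g_trans (Ltr i) State_a = [State_a, State_b, State_a, State_b] ! i"
| "g_trans (Ltr i) State_b = [State_a, State_b, State_a, State_b] ! i"
| "g_trans (Dot i) q = undefined"

fun g_out :: "letter \<Rightarrow> g_state \<Rightarrow> letter list" where
  "g_out (Ltr i) State_a = [Ltr ([0, 0, 1, 1] ! i)]"
| "g_out (Ltr i) State_b = [Ltr ([2, 2, 3, 3] ! i)]"
| "g_out (Dot i) q = undefined"

definition g_transducer :: "g_state transducer" where
  "g_transducer = \<lparr>states = {State_a, State_b}, trans_fn = g_trans, out_fn = g_out\<rparr>"

end

theory Submission
  imports Defs "HOL-Number_Theory.Cong"
begin

text \<open>
  Encode a digit of \<open>X_4\<close> by two bits. Started in a state with bit \<open>s\<close> (\<open>a\<close> is \<open>0\<close>, \<open>b\<close> is \<open>1\<close>),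
  \<open>g\<close> puts \<open>s\<close> in front of the bit sequence of its input, so it maps the Cantor space onto one half
  of it, a union of two cones. Split the domain of \<open>h\<close> into the cones of the \<open>r * 4^L\<close> words of
  length \<open>L + 1\<close>, where \<open>L\<close> is a synchronizing level. As \<open>h\<close> is a bijection, the images of
  these cones split \<open>Cantor_dot 4 r\<close> into \<open>2 * r * 4^L\<close> cones. The number of cones in such a
  splitting is determined modulo \<open>3\<close>, so \<open>2 * r\<close> is congruent to \<open>r\<close>.
\<close>

section \<open>Finite and infinite words, and their splitting into cones\<close>

lemma run_append: "run T (v @ w) q = run T w (run T v q)"
  by (induction v arbitrary: q) auto

lemma out_word_append: "out_word T (v @ w) q = out_word T v q @ out_word T w (run T v q)"
  by (induction v arbitrary: q) auto

lemma readable_append: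
  "readable n r A (v @ w) q \<longleftrightarrow> readable n r A v q \<and> readable n r A w (run A v q)"
  by (induction v arbitrary: q) auto

lemma Xplus_append:
  assumes "u \<in> Xplus n r" and "w \<in> lists (alph n)"
  shows "u @ w \<in> Xplus n r"
  using assms unfolding Xplus_def by auto

text \<open>Words grow at the right end, matching \<open>run_snoc\<close> and
  \<open>out_word_snoc\<close>. The base case is the single transition out of the initial state, the
  only one that reads a dotted letter.\<close>

lemma Xplus_induct [consumes 1, case_names dot snoc]:
  assumes "u \<in> Xplus n r"
    and dot: "\<And>a. a \<in> dots r \<Longrightarrow> P [a]"
    and snoc: "\<And>u i. u \<in> Xplus n r \<Longrightarrow> i \<in> alph n \<Longrightarrow> P u \<Longrightarrow> P (u @ [i])"
  shows "P u"
proof -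
  obtain a w where u: "u = a # w" and a: "a \<in> dots r" and w: "w \<in> lists (alph n)"
    using assms(1) unfolding Xplus_def by auto
  from w have "P (a # w)"
  proof (induction w rule: rev_induct)
    case Nil
    then show ?case by (simp add: dot a)
  next
    case (snoc i w)
    then have "a # w \<in> Xplus n r" using a by (auto simp: Xplus_def)
    then show ?case using snoc assms(3)[of "a # w" i] by auto
  qed
  then show ?thesis by (simp add: u)
qed

lemma Xplus_conc_Cantor:
  assumes "u \<in> Xplus n r" and "x \<in> Cantor n"
  shows "u \<frown> x \<in> Cantor_dot n r"
proof -
  obtain a w where u: "u = a # w" and a: "a \<in> dots r" and w: "w \<in> lists (alph n)"
    using assms(1) unfolding Xplus_def by auto
  have "w \<frown> x \<in> Cantor n"
    using w assms(2) by (auto simp: Cantor_def conc_def in_lists_conv_set)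
  then show ?thesis using a by (auto simp: u Cantor_dot_def)
qed

lemma Cantor_dot_split:
  assumes "x \<in> Cantor_dot n r"
  obtains u y where "u \<in> Xplus n r" and "length u = Suc L" and "y \<in> Cantor n" and "x = u \<frown> y"
proof -
  obtain a z where x: "x = a ## z" and a: "a \<in> dots r" and z: "z \<in> Cantor n"
    using assms unfolding Cantor_dot_def by auto
  have "a # prefix L z \<in> Xplus n r"
    using a z by (auto simp: Xplus_def Cantor_def in_lists_conv_set)
  moreover have "suffix L z \<in> Cantor n" using z by (auto simp: Cantor_def)
  moreover have "x = (a # prefix L z) \<frown> suffix L z" by (simp add: x)
  ultimately show thesis using that[of "a # prefix L z" "suffix L z"] by simp
qed

lemma finite_Xplus_length: "finite {u \<in> Xplus n r. length u = Suc L}"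
  and card_Xplus_length: "card {u \<in> Xplus n r. length u = Suc L} = r * n ^ L"
proof -
  let ?D = "dots r \<times> {w. set w \<subseteq> alph n \<and> length w = L}"
  have eq: "{u \<in> Xplus n r. length u = Suc L} = (\<lambda>(a, w). a # w) ` ?D"
    by (auto simp: Xplus_def image_iff)
  have fin: "finite (alph n)" "finite (dots r)" by (auto simp: alph_def dots_def)
  have card: "card (alph n) = n" "card (dots r) = r"
    by (auto simp: alph_def dots_def card_image inj_on_def)
  have inj: "inj_on (\<lambda>(a, w). a # w) ?D" by (auto simp: inj_on_def)
  show "finite {u \<in> Xplus n r. length u = Suc L}"
    unfolding eq using fin by (intro finite_imageI finite_cartesian_product finite_lists_length_eq)
  show "card {u \<in> Xplus n r. length u = Suc L} = r * n ^ L"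
    unfolding eq card_image[OF inj] card_cartesian_product
    by (simp add: card_lists_length_eq fin card)
qed

text \<open>Replaces the \<open>LEAST\<close> in \<open>omega_output\<close> by any sufficiently
  long prefix: longer inputs only extend the output, so a letter once written never changes.\<close>

lemma omega_output_eqI:
  assumes "\<And>m. \<exists>k l. m < l \<and> out_word T (prefix k x) q = prefix l y"
  shows "omega_output T q x = y"
proof
  fix m
  let ?o = "\<lambda>k. out_word T (prefix k x) q"
  have mono: "\<exists>v. ?o k' = ?o k @ v" if "k \<le> k'" for k k'
  proof -
    have "prefix k' x = prefix k x @ x [k \<rightarrow> k']"
      using that by (metis le0 subsequence_append le_add_diff_inverse)
    then show ?thesis by (simp add: out_word_append)
  qed
  obtain k l where l: "m < l" and k: "?o k = prefix l y" using assms by blast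
  define j where "j = (LEAST k. m < length (?o k))"
  have "m < length (?o k)" using l k by simp
  then have j: "m < length (?o j)" and "j \<le> k"
    unfolding j_def by (rule LeastI, rule Least_le)
  then obtain v where "?o k = ?o j @ v" using mono by blast
  then have "?o j ! m = ?o k ! m" using j by (simp add: nth_append)
  also have "\<dots> = y m" using l by (simp add: k)
  finally show "omega_output T q x m = y m" by (simp add: omega_output_def j_def)
qed

section \<open>Runs of an initial transducer from its initial state\<close>

context
  fixes n r :: nat and A :: "'q itransducer"
  assumes A: "initial_transducer n r A"
begin

text \<open>No transition returns to the initial state, so every letter after the dotted one is read
  in a state whose alphabet is \<open>alph n\<close>.\<close>

lemma run_Xplus:
  assumes "u \<in> Xplus n r"
  shows "readable n r A u (init A) \<and> run A u (init A) \<in> states A - {init A}"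
  using assms
proof (induction rule: Xplus_induct)
  case (dot a)
  then show ?case using A by (auto simp: initial_transducer_def letters_at_def)
next
  case (snoc u i)
  then have "i \<in> letters_at n r A (run A u (init A))" by (auto simp: letters_at_def)
  then show ?case
    using snoc.IH A by (auto simp: initial_transducer_def readable_append run_snoc)
qed

text \<open>Nothing is written while the run stays in \<open>rstates A\<close>. Entering
  \<open>sstates A\<close> writes a word starting with a dotted letter, and from then on only
  undotted letters are appended.\<close>

lemma out_word_Xplus:
  assumes "u \<in> Xplus n r"
  shows "(run A u (init A) \<in> rstates A \<longrightarrow> out_word A u (init A) = []) \<and>
    (run A u (init A) \<in> sstates A \<longrightarrow> out_word A u (init A) \<in> Xplus n r)"
  using assms
proof (induction rule: Xplus_induct)
  case (dot a)
  then show ?case using A by (auto simp: initial_transducer_def letters_at_def)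
next
  case (snoc u i)
  let ?p = "run A u (init A)"
  have p: "?p \<in> states A" "i \<in> letters_at n r A ?p"
    using run_Xplus[OF snoc.hyps(1)] snoc.hyps(2) by (auto simp: letters_at_def)
  show ?case
  proof (cases "?p \<in> rstates A")
    case True
    then show ?thesis
      using snoc.IH p A by (auto simp: initial_transducer_def run_snoc out_word_snoc)
  next
    case False
    then have S: "?p \<in> sstates A" using p by (simp add: sstates_def)
    then have "trans_fn A i ?p \<in> sstates A" "out_fn A i ?p \<in> lists (alph n)"
      using A snoc.hyps(2) by (auto simp: initial_transducer_def)
    then show ?thesis using S snoc.IH Xplus_append
      by (auto simp: run_snoc out_word_snoc sstates_def)
  qed
qed

text \<open>A loop is a cycle of length one, and no state of \<open>rstates A\<close> lies on a
  cycle.\<close>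

lemma run_in_sstates_if_loop:
  assumes "u \<in> Xplus n r" and "i \<in> alph n" and "trans_fn A i (run A u (init A)) = run A u (init A)"
  shows "run A u (init A) \<in> sstates A"
proof -
  let ?p = "run A u (init A)"
  have "readable n r A [i] ?p" "run A [i] ?p = ?p"
    using run_Xplus[OF assms(1)] assms(2,3) by (auto simp: letters_at_def)
  then have "?p \<notin> rstates A" using A unfolding initial_transducer_def by blast
  then show ?thesis using run_Xplus[OF assms(1)] by (simp add: sstates_def)
qed

text \<open>Cut \<open>u\<close> before its last \<open>?k\<close> letters. The strict inequality
  leaves the dotted letter in the front part, so the part that leads into the core is a word over
  \<open>alph n\<close>.\<close>

lemma run_in_core:
  assumes "u \<in> Xplus n r" and "(LEAST k. sync_level n r A k) < length u"
  shows "run A u (init A) \<in> states (core n r A)"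
proof -
  let ?k = "LEAST k. sync_level n r A k"
  define v where "v = take (length u - ?k) u"
  define w where "w = drop (length u - ?k) u"
  have u: "u = v @ w" by (simp add: v_def w_def)
  obtain j where j: "length u - ?k = Suc j"
    using assms(2) by (metis Suc_diff_Suc)
  obtain a x where ax: "u = a # x" "a \<in> dots r" "x \<in> lists (alph n)"
    using assms(1) by (auto simp: Xplus_def)
  have "v = a # take j x" "w = drop j x" by (simp_all add: v_def w_def j) (simp_all add: ax(1))
  then have v: "v \<in> Xplus n r" and w: "w \<in> lists (alph n)"
    using ax(2,3) by (auto simp: Xplus_def dest: in_set_takeD in_set_dropD)
  have "length w = ?k" using assms(2) by (simp add: w_def)
  moreover have "readable n r A w (run A v (init A))" "run A v (init A) \<in> states A"
    using run_Xplus[OF assms(1)] run_Xplus[OF v] by (auto simp: u readable_append)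
  ultimately show ?thesis using w by (auto simp: core_def u run_append)
qed

end

section \<open>The map induced by \<open>g\<close>, in terms of bits\<close>

fun digit :: "letter \<Rightarrow> nat" where
  "digit (Ltr i) = i"
| "digit (Dot i) = i"

fun g_bit :: "g_state \<Rightarrow> nat" where
  "g_bit State_a = 0"
| "g_bit State_b = 1"

text \<open>With a digit read as twice its high bit plus its low bit, output digit \<open>k\<close>
  joins the low bit of input digit \<open>k - 1\<close> to the high bit of input digit
  \<open>k\<close>. The state supplies the missing bit at the start.\<close>

definition shift_bit :: "g_state \<Rightarrow> letter word \<Rightarrow> letter word" where
  "shift_bit s x =
     (\<lambda>k. Ltr (2 * (if k = 0 then g_bit s else digit (x (k - 1)) mod 2) + digit (x k) div 2))"

lemma less_4_cases: "i < 4 \<Longrightarrow> i = 0 \<or> i = 1 \<or> i = 2 \<or> i = (3::nat)"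
  by arith

lemma two_bits_less_4: "c \<le> 1 \<Longrightarrow> d \<le> 1 \<Longrightarrow> 2 * c + d < (4::nat)"
  by arith

lemma g_bit_trans: "i \<in> alph 4 \<Longrightarrow> g_bit (g_trans i s) = digit i mod 2"
  by (cases s) (auto simp: alph_def dest!: less_4_cases)

lemma g_out_eq: "i \<in> alph 4 \<Longrightarrow> g_out i s = [Ltr (2 * g_bit s + digit i div 2)]"
  by (cases s) (auto simp: alph_def dest!: less_4_cases)

text \<open>The state of \<open>g\<close> remembers the low bit of the last digit read. Both claims
  go through one induction, as the next output letter depends on that bit.\<close>

lemma out_word_g:
  assumes "x \<in> Cantor 4"
  shows "out_word g_transducer (prefix k x) s = prefix k (shift_bit s x)"
    and "g_bit (run g_transducer (prefix k x) s) =
           (if k = 0 then g_bit s else digit (x (k - 1)) mod 2)"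
proof (induction k)
  case 0
  show "out_word g_transducer (prefix 0 x) s = prefix 0 (shift_bit s x)" by simp
  show "g_bit (run g_transducer (prefix 0 x) s) =
          (if 0 = (0::nat) then g_bit s else digit (x (0 - 1)) mod 2)" by simp
next
  case (Suc k)
  have k: "x k \<in> alph 4" using assms by (simp add: Cantor_def)
  have g: "trans_fn g_transducer = g_trans" "out_fn g_transducer = g_out"
    by (simp_all add: g_transducer_def)
  show "out_word g_transducer (prefix (Suc k) x) s = prefix (Suc k) (shift_bit s x)"
    using Suc by (simp add: out_word_snoc g g_out_eq[OF k] shift_bit_def)
  show "g_bit (run g_transducer (prefix (Suc k) x) s) =
          (if Suc k = 0 then g_bit s else digit (x (Suc k - 1)) mod 2)"
    by (simp add: run_snoc g g_bit_trans[OF k])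
qed

text \<open>The output bits after the first are the freely chosen input bits, so the only constraint
  falls on the high bit of the first digit.\<close>

lemma shift_bit_image: "shift_bit s ` Cantor 4 = {y \<in> Cantor 4. digit (y 0) div 2 = g_bit s}"
proof (intro equalityI subsetI)
  fix y assume "y \<in> shift_bit s ` Cantor 4"
  then obtain x where x: "x \<in> Cantor 4" and y: "y = shift_bit s x" by blast
  have d: "digit (x k) < 4" for k
    using x by (auto simp: Cantor_def alph_def) (metis digit.simps(1) imageE lessThan_iff)
  then have d2: "digit (x k) div 2 \<le> 1" for k
    by (simp add: less_Suc_eq_le[symmetric] less_mult_imp_div_less)
  have "g_bit s \<le> 1" by (cases s) auto
  then have "(if k = 0 then g_bit s else digit (x (k - 1)) mod 2) \<le> 1" for k
    by (simp add: less_Suc_eq_le[symmetric] numeral_2_eq_2[symmetric])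
  then have "2 * (if k = 0 then g_bit s else digit (x (k - 1)) mod 2) + digit (x k) div 2 < 4" for k
    using d2[of k] by (rule two_bits_less_4)
  then have "y \<in> Cantor 4" by (simp add: y shift_bit_def Cantor_def alph_def)
  moreover have "digit (y 0) div 2 = g_bit s" using d2[of 0] by (simp add: y shift_bit_def)
  ultimately show "y \<in> {y \<in> Cantor 4. digit (y 0) div 2 = g_bit s}" by simp
next
  fix y assume "y \<in> {y \<in> Cantor 4. digit (y 0) div 2 = g_bit s}"
  then have y: "y \<in> Cantor 4" and y0: "digit (y 0) div 2 = g_bit s" by auto
  have yk: "y k = Ltr (digit (y k))" "digit (y k) < 4" for k
  proof -
    have "y k \<in> alph 4" using y by (simp add: Cantor_def)
    then show "y k = Ltr (digit (y k))" "digit (y k) < 4" by (auto simp: alph_def)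
  qed
  \<comment> \<open>The preimage: drop the first bit of \<open>y\<close> and regroup the others in
    pairs.\<close>
  define x where "x = (\<lambda>k. Ltr (2 * (digit (y k) mod 2) + digit (y (Suc k)) div 2))"
  have d2: "digit (y k) div 2 \<le> 1" for k
    using yk(2)[of k] by (simp add: less_Suc_eq_le[symmetric] less_mult_imp_div_less)
  have "2 * (digit (y k) mod 2) + digit (y (Suc k)) div 2 < 4" for k
    by (rule two_bits_less_4) (use d2[of "Suc k"] in simp_all)
  then have "x \<in> Cantor 4" by (simp add: x_def Cantor_def alph_def)
  moreover have "shift_bit s x = y"
  proof
    fix k
    have m: "digit (x j) mod 2 = digit (y (Suc j)) div 2" for j
      using d2[of "Suc j"] by (simp add: x_def mod_less)
    have q: "digit (x k) div 2 = digit (y k) mod 2"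
      using d2[of "Suc k"] by (simp add: x_def)
    have "(if k = 0 then g_bit s else digit (x (k - 1)) mod 2) = digit (y k) div 2"
      using y0 m[of "k - 1"] by simp
    then show "shift_bit s x k = y k"
      by (simp add: shift_bit_def q yk(1)[symmetric])
  qed
  ultimately show "y \<in> shift_bit s ` Cantor 4" by blast
qed

section \<open>Counting the words of fixed length inside a half cone\<close>

lemma card_half_words:
  "card {w \<in> lists (alph 4). length w = Suc l \<and> digit (hd w) div 2 = g_bit s} = 2 * 4 ^ l"
proof -
  let ?B = "{a \<in> alph 4. digit a div 2 = g_bit s}"
  let ?D = "?B \<times> {w. set w \<subseteq> alph 4 \<and> length w = l}"
  have "?B = {Ltr (2 * g_bit s), Ltr (2 * g_bit s + 1)}"
    by (cases s) (auto simp: alph_def dest!: less_4_cases)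
  then have "card ?B = 2" by simp
  moreover have "{w \<in> lists (alph 4). length w = Suc l \<and> digit (hd w) div 2 = g_bit s}
          = (\<lambda>(a, w). a # w) ` ?D"
    by (auto simp: length_Suc_conv image_iff subset_iff)
  moreover have "inj_on (\<lambda>(a, w). a # w) ?D" by (auto simp: inj_on_def)
  moreover have "finite (alph 4)" "card (alph 4) = 4"
    by (auto simp: alph_def card_image inj_on_def)
  ultimately show ?thesis
    by (simp add: card_image card_cartesian_product card_lists_length_eq)
qed

text \<open>Padding with zeros turns inclusion of cones into membership of a point. As
  \<open>y\<close> is longer than \<open>v\<close>, it already contains the digit after
  \<open>v\<close> whose high bit decides membership. That digit has two choices and the next
  \<open>l\<close> digits are free.\<close>

lemma card_padded_half_cone:
  assumes v: "v \<in> Xplus 4 r" and N: "N = length v + l"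
  shows "card {y \<in> Xplus 4 r. length y = Suc N \<and>
    y \<frown> const_word 0 \<in> (\<lambda>z. v \<frown> z) ` shift_bit s ` Cantor 4} = 2 * 4 ^ l"
    (is "card ?F = _")
proof -
  let ?H = "{w \<in> lists (alph 4). length w = Suc l \<and> digit (hd w) div 2 = g_bit s}"
  have "?F = (\<lambda>w. v @ w) ` ?H"
  proof (intro equalityI subsetI)
    fix y assume "y \<in> ?F"
    then obtain z where len: "length y = Suc N" and eq: "y \<frown> const_word 0 = v \<frown> z"
      and z: "z \<in> Cantor 4" "digit (z 0) div 2 = g_bit s"
      unfolding shift_bit_image by auto
    have "y = prefix (Suc N) (y \<frown> const_word 0)" by (simp flip: len)
    also have "\<dots> = v @ prefix (Suc l) z"
      unfolding eq by (rule nth_equalityI) (auto simp: N conc_def nth_append simp del: subseq_to_Suc)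
    finally have "y = v @ prefix (Suc l) z" .
    moreover have "prefix (Suc l) z \<in> ?H"
      using z by (auto simp: Cantor_def in_lists_conv_set hd_conv_nth simp del: subseq_to_Suc)
    ultimately show "y \<in> (\<lambda>w. v @ w) ` ?H" by blast
  next
    fix y assume "y \<in> (\<lambda>w. v @ w) ` ?H"
    then obtain w where y: "y = v @ w" and w: "w \<in> lists (alph 4)" "length w = Suc l"
      "digit (hd w) div 2 = g_bit s" by blast
    have "w \<frown> const_word 0 \<in> Cantor 4"
      using w(1) by (auto simp: Cantor_def conc_def const_word_def alph_def in_lists_conv_set)
    moreover have "(w \<frown> const_word 0) 0 = hd w" using w(2) by (cases w) auto
    ultimately have "w \<frown> const_word 0 \<in> shift_bit s ` Cantor 4"
      using w(3) by (simp add: shift_bit_image)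
    then have "y \<frown> const_word 0 \<in> (\<lambda>z. v \<frown> z) ` shift_bit s ` Cantor 4"
      unfolding y conc_conc[symmetric] by (rule imageI)
    then show "y \<in> ?F" using Xplus_append[OF v w(1)] w(2) by (simp add: y N)
  qed
  moreover have "inj_on (\<lambda>w. v @ w) ?H" by (simp add: inj_on_def)
  ultimately show ?thesis by (simp add: card_image card_half_words)
qed

section \<open>Comparing two cone counts modulo 3\<close>

theorem lemma8p15:
  fixes r :: nat and A :: "'q itransducer"
  assumes "1 \<le> r" and "r \<le> 3"
    and "A \<in> TB 4 r"
    and "same_transducer 4 (core 4 r A) g_transducer"
  shows "r = 3"
proof -
  have A: "initial_transducer 4 r A" using assms(3) by (simp add: TB_def minimal_def)
  obtain h where rep: "represents 4 r A h"
    and hom: "homeomorphic_map (cantor_topology 4 r) (cantor_topology 4 r) h"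
    using assms(3) by (auto simp: TB_def)
  have "topspace (cantor_topology 4 r) = Cantor_dot 4 r" by (simp add: cantor_topology_def)
  then have inj: "inj_on h (Cantor_dot 4 r)" and surj: "h ` Cantor_dot 4 r = Cantor_dot 4 r"
    using homeomorphic_imp_injective_map[OF hom] homeomorphic_imp_surjective_map[OF hom] by auto
  obtain f where "bij_betw f (states (core 4 r A)) (states g_transducer)"
    and f: "\<And>q i. q \<in> states (core 4 r A) \<Longrightarrow> i \<in> alph 4 \<Longrightarrow>
      f (trans_fn A i q) = trans_fn g_transducer i (f q) \<and> out_fn A i q = out_fn g_transducer i (f q)"
    using assms(4) by (auto simp: same_transducer_def core_def)
  then have f_inj: "inj_on f (states (core 4 r A))" by (simp add: bij_betw_def)
  define L where "L = (LEAST k. sync_level 4 r A k)"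
  \<comment> \<open>The extra letter is the dotted one; the \<open>L\<close> undotted letters after
    it bring the run into the core.\<close>
  define U where "U = {u \<in> Xplus 4 r. length u = Suc L}"
  define state where "state u = run A u (init A)" for u
  define out where "out u = out_word A u (init A)" for u
  have core: "state u \<in> states (core 4 r A)" if "u \<in> Xplus 4 r" "L < length u" for u
    using run_in_core[OF A] that by (simp add: state_def L_def)
  \<comment> \<open>The run stays in the core, where \<open>f\<close> may be applied, because
    \<open>u @ w\<close> is again a word of \<open>Xplus 4 r\<close> longer than
    \<open>L\<close>.\<close>
  have sim: "f (run A w (state u)) = run g_transducer w (f (state u)) \<and>
      out_word A w (state u) = out_word g_transducer w (f (state u))"
    if u: "u \<in> Xplus 4 r" "L < length u" and w: "w \<in> lists (alph 4)" for u w
    using w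
  proof (induction w rule: rev_induct)
    case (snoc i w)
    then have "run A w (state u) \<in> states (core 4 r A)"
      using core[of "u @ w"] Xplus_append[of u 4 r w] u by (simp add: state_def run_append)
    then show ?case using f[of "run A w (state u)" i] snoc
      by (simp add: run_snoc out_word_snoc)
  qed simp
  have out: "out u \<in> Xplus 4 r" if "u \<in> U" for u
  proof -
    have u: "u \<in> Xplus 4 r" "L < length u" using that by (auto simp: U_def)
    \<comment> \<open>In \<open>g\<close>, letter 0 loops at \<open>State_a\<close> and letter 3 at
      \<open>State_b\<close>. Injectivity of \<open>f\<close> gives a loop at
      \<open>state u\<close>, so this state is in \<open>sstates A\<close> and a dotted letter has
      already been written.\<close>
    define i where "i = (case f (state u) of State_a \<Rightarrow> Ltr 0 | State_b \<Rightarrow> Ltr 3)"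
    have i: "i \<in> alph 4" by (auto simp: i_def alph_def split: g_state.split)
    have "f (trans_fn A i (state u)) = f (state u)"
      using sim[OF u, of "[i]"] i
      by (auto simp: i_def g_transducer_def split: g_state.split)
    moreover have "trans_fn A i (state u) \<in> states (core 4 r A)"
      using core[of "u @ [i]"] Xplus_append[of u 4 r "[i]"] u i by (simp add: state_def run_snoc)
    ultimately have "trans_fn A i (state u) = state u"
      using f_inj core[OF u] by (auto dest: inj_onD)
    then have "state u \<in> sstates A"
      using run_in_sstates_if_loop[OF A u(1) i] by (simp add: state_def)
    then show ?thesis using out_word_Xplus[OF A u(1)] by (simp add: state_def out_def)
  qed
  have h: "h (u \<frown> x) = out u \<frown> shift_bit (f (state u)) x" if "u \<in> U" "x \<in> Cantor 4" for u x
  proof -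
    have u: "u \<in> Xplus 4 r" "L < length u" using that by (auto simp: U_def)
    \<comment> \<open>Past \<open>u\<close>, each letter read produces exactly one letter, so
      \<open>Suc m\<close> further letters of input are enough.\<close>
    have "\<exists>k l. m < l \<and> out_word A (prefix k (u \<frown> x)) (init A) =
        prefix l (out u \<frown> shift_bit (f (state u)) x)" for m
    proof (intro exI conjI)
      have pre: "prefix (length v + j) (v \<frown> z) = v @ prefix j z"
        for v and z :: "letter word" and j
        by (rule nth_equalityI) (auto simp: conc_def nth_append)
      have "prefix (Suc m) x \<in> lists (alph 4)"
        using that(2) by (auto simp: Cantor_def in_lists_conv_set)
      then show "out_word A (prefix (length u + Suc m) (u \<frown> x)) (init A) =
          prefix (length (out u) + Suc m) (out u \<frown> shift_bit (f (state u)) x)"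
        using sim[OF u] out_word_g(1)[OF that(2)]
        unfolding pre by (simp add: out_word_append out_def state_def del: subseq_to_Suc)
    qed simp
    then have "omega_output A (init A) (u \<frown> x) = out u \<frown> shift_bit (f (state u)) x"
      by (rule omega_output_eqI)
    then show ?thesis
      using rep Xplus_conc_Cantor[OF u(1) that(2)] by (simp add: represents_def)
  qed
  define cone where "cone u = (\<lambda>x. u \<frown> x) ` Cantor 4" for u
  have h_cone: "h ` cone u = (\<lambda>z. out u \<frown> z) ` shift_bit (f (state u)) ` Cantor 4" if "u \<in> U" for u
    using h[OF that] by (force simp: cone_def image_iff)
  have cone_sub: "cone u \<subseteq> Cantor_dot 4 r" if "u \<in> U" for u
    using that Xplus_conc_Cantor by (auto simp: cone_def U_def)
  have fin: "finite U" unfolding U_def by (rule finite_Xplus_length)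
  \<comment> \<open>A common depth: words of length \<open>Suc N\<close> refine all the half cones
    that arise as images.\<close>
  obtain N where N: "\<And>u. u \<in> U \<Longrightarrow> length (out u) \<le> N"
    using fin by (meson finite_imageI Max_ge imageI)
  define W where "W = {y \<in> Xplus 4 r. length y = Suc N}"
  \<comment> \<open>Each word of \<open>W\<close> is represented by one point of its cone.
    Surjectivity of \<open>h\<close> makes the sets \<open>F u\<close> cover \<open>W\<close>, and
    injectivity makes them disjoint.\<close>
  define F where "F u = {y \<in> W. y \<frown> const_word 0 \<in> h ` cone u}" for u
  have card_F: "card (F u) = 2 * 4 ^ (N - length (out u))" if "u \<in> U" for u
    using card_padded_half_cone[OF out[OF that], of N "N - length (out u)"] N[OF that]
    by (simp add: F_def W_def h_cone[OF that] conj_assoc)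
  have "W = (\<Union>u\<in>U. F u)"
  proof (intro equalityI subsetI)
    fix y assume y: "y \<in> W"
    have "const_word 0 \<in> Cantor 4" by (simp add: const_word_def Cantor_def alph_def)
    then have "y \<frown> const_word 0 \<in> h ` Cantor_dot 4 r"
      using Xplus_conc_Cantor y unfolding surj by (auto simp: W_def)
    then obtain x where x: "x \<in> Cantor_dot 4 r" "y \<frown> const_word 0 = h x" by blast
    obtain u where "u \<in> U" "x \<in> cone u"
      by (rule Cantor_dot_split[OF x(1), of L]) (auto simp: U_def cone_def)
    then show "y \<in> (\<Union>u\<in>U. F u)" using y x(2) by (auto simp: F_def)
  qed (auto simp: F_def)
  moreover have "F u \<inter> F u' = {}" if uu': "u \<in> U" "u' \<in> U" "u \<noteq> u'" for u u'
  proof -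
    have "cone u \<inter> cone u' = {}"
    proof -
      have "u = u'" if "u \<frown> x = u' \<frown> x'" for x x'
      proof -
        have "length u = length u'" using uu' by (simp add: U_def)
        then show ?thesis using that prefix_conc_length by metis
      qed
      then show ?thesis using uu'(3) by (auto simp: cone_def)
    qed
    then have "h ` cone u \<inter> h ` cone u' = {}"
      using inj_on_image_Int[OF inj cone_sub[OF uu'(1)] cone_sub[OF uu'(2)]] by simp
    then show ?thesis by (auto simp: F_def)
  qed
  moreover have "finite (F u)" for u
    by (rule finite_subset[of _ W]) (auto simp: F_def W_def finite_Xplus_length)
  ultimately have "card W = (\<Sum>u\<in>U. card (F u))"
    using fin by (simp add: card_UN_disjoint)
  then have count: "r * 4 ^ N = (\<Sum>u\<in>U. 2 * 4 ^ (N - length (out u)))"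
    using card_F by (simp add: W_def card_Xplus_length)
  \<comment> \<open>Modulo 3 all powers of 4 become 1, which removes \<open>N\<close>,
    \<open>L\<close> and the output lengths from \<open>count\<close>; the right side becomes twice
    \<open>card U\<close>, that is \<open>2 * r\<close>.\<close>
  have pow: "[4 ^ k = 1] (mod 3 :: nat)" for k
    using cong_pow[of 4 1 "3::nat" k] by (simp add: cong_def)
  have "[r * 4 ^ N = r * 1] (mod 3)" by (intro cong_mult cong_refl pow)
  moreover have "[(\<Sum>u\<in>U. 2 * 4 ^ (N - length (out u))) = (\<Sum>u\<in>U. 2 * 1)] (mod 3 :: nat)"
    by (intro cong_sum cong_mult cong_refl pow)
  moreover have "[r * 4 ^ L * 2 = r * 1 * 2] (mod 3)" by (intro cong_mult cong_refl pow)
  ultimately have "[r = 2 * r] (mod 3)"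
    using count card_Xplus_length[of 4 r L] by (simp add: U_def cong_def mult_ac)
  then have "r mod 3 = 2 * r mod 3" by (simp add: cong_def)
  \<comment> \<open>The congruence says that 3 divides \<open>r\<close>.\<close>
  then show "r = 3" using assms(1,2) by presburger
qed

end
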